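(* Let $A\in\mathbb{R}^{m\times n}$, $\bar x\in\mathbb{R}^n$, $\bar y=|A\bar x|^2\in\mathbb{R}^m$ and $\overline{\mathcal F}=\{w\in\mathbb{R}^m : |w|=\sqrt{\bar y}\}$. Let $R:\mathbb{R}^n\to\mathbb{R}\cup\{+\infty\}$ be a proper and lower semicontinuous function. Assume that: (i) $A(\mathrm{dom}(R))\cap\overline{\mathcal F}\neq\emptyset$; (ii) $R$ is non-negative; (iii) $\ker(R_\infty)\cap\ker(A)=\{0\}$. Then the set of minimizers of $R$ over $\{x\in\mathbb{R}^n : Ax\in\overline{\mathcal F}\}$, i.e. the set of solutions of $$\inf_{x\in\mathbb{R}^n} R(x)\quad\text{subject to}\quad |Ax|=\sqrt{\bar y},$$ is a non-empty compact set.
   Context: For a vector $w\in\mathbb{R}^m$, the operations $|w|$, $w^2$ and $\sqrt{w}$ are componentwise. $\mathrm{dom}(R)=\{x: R(x)<+\infty\}$. $R_\infty$ is the asymptotic (recession) function $R_\infty(z)=\liminf_{z'\to z,\ t\to+\infty} R(tz')/t$. For a function $f$ on $\mathbb{R}^n$, $\ker(f)=\{z\in\mathbb{R}^n: f(z)=0\}$; $\ker(A)$ is the usual null space. No convexity of $R$ is assumed. *)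

theory Defs
  imports "HOL-Analysis.Analysis"
begin

(* On real vectors, the library's \<bar>w\<bar> and w\<^sup>2 are already componentwise
   (abs_vec_def, times_vec_def); only the componentwise square root is missing. *)
definition vec_sqrt :: "real ^ 'm \<Rightarrow> real ^ 'm" where
  "vec_sqrt w = (\<chi> i. sqrt (w $ i))"

(* Functions into \<real> \<union> {+\<infinity>} are ereal-valued; properness excludes the value -\<infinity>. *)
definition proper_fun :: "('a \<Rightarrow> ereal) \<Rightarrow> bool" where
  "proper_fun f \<longleftrightarrow> (\<forall>x. f x \<noteq> -\<infinity>) \<and> (\<exists>x. f x < \<infinity>)"

definition lower_semicontinuous :: "('a::topological_space \<Rightarrow> ereal) \<Rightarrow> bool" where
  "lower_semicontinuous f \<longleftrightarrow> (\<forall>x. f x \<le> Liminf (at x) f)"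

definition eff_dom :: "('a \<Rightarrow> ereal) \<Rightarrow> 'a set" where
  "eff_dom f = {x. f x < \<infinity>}"

(* nhds rather than at: z' = z is allowed in the joint lower limit. *)
definition asymptotic_fun :: "('a::real_normed_vector \<Rightarrow> ereal) \<Rightarrow> 'a \<Rightarrow> ereal" where
  "asymptotic_fun f z =
     Liminf (nhds z \<times>\<^sub>F at_top) (\<lambda>(z', t::real). f (t *\<^sub>R z') / ereal t)"

definition fun_ker :: "('a \<Rightarrow> 'b::zero) \<Rightarrow> 'a set" where
  "fun_ker f = {z. f z = 0}"

definition minimizers :: "('a \<Rightarrow> ereal) \<Rightarrow> 'a set \<Rightarrow> 'a set" where
  "minimizers f C = {x. is_arg_min f (\<lambda>x. x \<in> C) x}"

end

theory Submission
  imports Defs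
begin

text \<open>A sublevel set of \<open>R\<close> inside the feasible set is closed by lower semicontinuity. If it were
  unbounded, the normalised points of a divergent sequence in it would accumulate at a unit vector
  \<open>d\<close>; as \<open>A\<close> is bounded on the feasible set and \<open>R\<close> on the sublevel set, \<open>A d = 0\<close> and
  \<open>R\<^sub>\<infinity> d = 0\<close>, which the kernel condition forbids. So these sublevel sets are compact, and
  the set of minimizers is the intersection of a nested family of nonempty ones.\<close>

lemma closed_sublevel_lower_semicontinuous:
  assumes "lower_semicontinuous f"
  shows "closed {x. f x \<le> c}"
proof -
  have "open {x. c < f x}"
    unfolding open_subopen[of "{x. c < f x}"]
  proof clarify
    fix x assume x: "c < f x"
    have "f x \<le> Liminf (at x) f"
      using assms by (simp add: lower_semicontinuous_def)
    with x have "\<forall>\<^sub>F y in at x. c < f y"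
      by (simp add: le_Liminf_iff)
    \<comment> \<open>\<open>lower_semicontinuous\<close> speaks of the punctured filter
      \<open>at x\<close>; since \<open>c < f x\<close> holds at the point itself, the bound extends
      to a full neighbourhood.\<close>
    with x have "\<forall>\<^sub>F y in nhds x. c < f y"
      unfolding eventually_at_filter by (auto elim: eventually_mono)
    then show "\<exists>T. open T \<and> x \<in> T \<and> T \<subseteq> {x. c < f x}"
      unfolding eventually_nhds by auto
  qed
  moreover have "{x. f x \<le> c} = - {x. c < f x}"
    by (auto simp: not_less)
  ultimately show ?thesis
    by (simp add: closed_def)
qed

text \<open>The pairs \<open>(u k, t k)\<close> converge to the product filter that defines
  \<open>asymptotic_fun\<close>, and a lower limit can only grow along such a path. This turns one
  well-chosen sequence into an upper bound.\<close>

lemma asymptotic_fun_le_Liminf: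
  assumes "(u \<longlongrightarrow> z) G" and "filterlim t at_top G"
  shows "asymptotic_fun f z \<le> Liminf G (\<lambda>k. f (t k *\<^sub>R u k) / ereal (t k))"
proof -
  let ?q = "\<lambda>(z', t::real). f (t *\<^sub>R z') / ereal t"
  have lim: "filterlim (\<lambda>k. (u k, t k)) (nhds z \<times>\<^sub>F at_top) G"
    using assms by (rule filterlim_Pair)
  have "\<forall>\<^sub>F k in G. y < f (t k *\<^sub>R u k) / ereal (t k)" if "y < asymptotic_fun f z" for y
  proof -
    have "\<forall>\<^sub>F p in nhds z \<times>\<^sub>F at_top. y < ?q p"
      using that le_Liminf_iff[of "asymptotic_fun f z" "nhds z \<times>\<^sub>F at_top" ?q]
      by (simp add: asymptotic_fun_def)
    from eventually_compose_filterlim[OF this lim] show ?thesis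
      by simp
  qed
  then show ?thesis
    by (simp add: le_Liminf_iff)
qed

lemma asymptotic_fun_nonneg:
  assumes "\<And>x. 0 \<le> f x"
  shows "0 \<le> asymptotic_fun f z"
proof -
  have "\<forall>\<^sub>F p in nhds z \<times>\<^sub>F at_top. (0::real) < snd p"
    by (rule eventually_compose_filterlim[OF eventually_gt_at_top filterlim_snd])
  then have "\<forall>\<^sub>F p in nhds z \<times>\<^sub>F at_top. 0 \<le> (\<lambda>(z', t::real). f (t *\<^sub>R z') / ereal t) p"
    by eventually_elim (auto simp: assms)
  then show ?thesis
    unfolding asymptotic_fun_def by (rule Liminf_bounded)
qed

lemma bounded_sublevel_asymptotic:
  fixes L :: "'a::euclidean_space \<Rightarrow> 'b::real_normed_vector"
  assumes L: "bounded_linear L"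
    and nonneg: "\<And>x. 0 \<le> R x"
    and ker: "fun_ker (asymptotic_fun R) \<inter> fun_ker L \<subseteq> {0}"
    and F: "bounded F"
  shows "bounded {x. L x \<in> F \<and> R x \<le> ereal c}" (is "bounded ?S")
proof (rule ccontr)
  assume "\<not> bounded ?S"
  then have "\<exists>x. x \<in> ?S \<and> real n < norm x" for n
    unfolding bounded_iff by (auto simp: not_le)
  then obtain x where x: "\<And>n. x n \<in> ?S" and norm_x: "\<And>n. real n < norm (x n)"
    by metis
  \<comment> \<open>The strict bound matters at \<open>n = 0\<close>: every \<open>x n\<close> is
    nonzero and can be normalised.\<close>
  have x0: "0 < norm (x n)" for n
    using norm_x[of n] by linarith
  define u where "u n = x n /\<^sub>R norm (x n)" for n
  have "u n \<in> sphere 0 1" for n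
    using x0[of n] by (simp add: u_def)
  then obtain d r where d: "d \<in> sphere 0 1" and r: "strict_mono r"
    and u_lim: "(u \<circ> r) \<longlonglongrightarrow> d"
    using compact_sphere unfolding compact_def by meson
  have norm_lim: "filterlim (\<lambda>n. norm (x n)) at_top sequentially"
    by (rule filterlim_at_top_mono[OF filterlim_real_sequentially])
      (simp add: less_imp_le[OF norm_x])
  have xr_lim: "filterlim (\<lambda>n. norm (x (r n))) at_top sequentially"
    by (rule filterlim_compose[OF norm_lim filterlim_subseq[OF r]])
  have "asymptotic_fun R d \<le>
      liminf (\<lambda>n. R (norm (x (r n)) *\<^sub>R (u \<circ> r) n) / ereal (norm (x (r n))))"
    by (rule asymptotic_fun_le_Liminf[OF u_lim xr_lim])
  \<comment> \<open>Scaling \<open>u\<close> back by the norm recovers \<open>x (r n)\<close>, where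
    \<open>R\<close> is at most \<open>c\<close>; dividing by a norm that diverges sends the bound
    to 0.\<close>
  also have "\<dots> \<le> liminf (\<lambda>n. ereal (c / norm (x (r n))))"
  proof (rule Liminf_mono, rule always_eventually, rule allI)
    fix n
    have "norm (x (r n)) *\<^sub>R (u \<circ> r) n = x (r n)"
      using x0[of "r n"] by (simp add: u_def)
    moreover have "R (x (r n)) / ereal (norm (x (r n))) \<le> ereal c / ereal (norm (x (r n)))"
      using x[of "r n"] x0[of "r n"] by (intro ereal_divide_right_mono) auto
    ultimately show "R (norm (x (r n)) *\<^sub>R (u \<circ> r) n) / ereal (norm (x (r n)))
        \<le> ereal (c / norm (x (r n)))"
      using x0[of "r n"] by simp
  qed
  also have "\<dots> = 0"
  proof -
    have "(\<lambda>n. c / norm (x (r n))) \<longlonglongrightarrow> 0"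
      by (rule real_tendsto_divide_at_top[OF tendsto_const xr_lim])
    then have "(\<lambda>n. ereal (c / norm (x (r n)))) \<longlonglongrightarrow> ereal 0"
      by simp
    then show ?thesis
      by (simp add: lim_imp_Liminf zero_ereal_def)
  qed
  finally have "asymptotic_fun R d = 0"
    using asymptotic_fun_nonneg[OF nonneg] by (rule antisym)
  moreover have "L d = 0"
  proof -
    obtain B where B: "\<And>w. w \<in> F \<Longrightarrow> norm w \<le> B"
      using F by (auto simp: bounded_iff)
    \<comment> \<open>By linearity \<open>L (u n)\<close> is \<open>L (x n)\<close> divided by
      \<open>norm (x n)\<close>, and \<open>L (x n)\<close> stays in the bounded set
      \<open>F\<close>.\<close>
    have "norm (L ((u \<circ> r) n)) \<le> B / norm (x (r n))" for n
      using B[of "L (x (r n))"] x[of "r n"] x0[of "r n"]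
      by (simp add: u_def linear_cmul[OF bounded_linear.linear[OF L]] field_simps)
    moreover have "(\<lambda>n. B / norm (x (r n))) \<longlonglongrightarrow> 0"
      by (rule real_tendsto_divide_at_top[OF tendsto_const xr_lim])
    ultimately have "(\<lambda>n. L ((u \<circ> r) n)) \<longlonglongrightarrow> 0"
      by (intro Lim_null_comparison[where f = "\<lambda>n. L ((u \<circ> r) n)"]) auto
    moreover have "(\<lambda>n. L ((u \<circ> r) n)) \<longlonglongrightarrow> L d"
      by (rule bounded_linear.tendsto[OF L u_lim])
    ultimately show ?thesis
      by (rule LIMSEQ_unique[symmetric])
  qed
  ultimately have "d = 0"
    using ker by (auto simp: fun_ker_def)
  with d show False
    by simp
qed

lemma minimizers_nonempty_compact:
  fixes R :: "'a::heine_borel \<Rightarrow> ereal"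
  assumes compact: "\<And>c. compact {x \<in> C. R x \<le> ereal c}"
    and nonneg: "\<And>x. 0 \<le> R x"
    and feasible: "x0 \<in> C" "R x0 < \<infinity>"
  shows "minimizers R C \<noteq> {} \<and> compact (minimizers R C)"
proof -
  \<comment> \<open>The infimum is a real number \<open>m\<close>: nonnegativity bounds it below,
    the feasible point \<open>x0\<close> above.\<close>
  have "0 \<le> (INF x\<in>C. R x)"
    using nonneg by (intro INF_greatest)
  moreover have "(INF x\<in>C. R x) < \<infinity>"
    using feasible by (meson INF_lower le_less_trans)
  ultimately obtain m where m: "(INF x\<in>C. R x) = ereal m"
    by (cases "INF x\<in>C. R x") auto
  have m_le: "ereal m \<le> R x" if "x \<in> C" for x
    using that m by (metis INF_lower)
  \<comment> \<open>The positive slack keeps each level strictly above the infimum, so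
    \<open>K n\<close> is nonempty before any minimizer is known; it shrinks to 0, so a point common
    to all \<open>K n\<close> attains \<open>m\<close>.\<close>
  define K where "K n = {x \<in> C. R x \<le> ereal (m + inverse (real (Suc n)))}" for n
  have "K n \<noteq> {}" for n
  proof -
    have "(INF x\<in>C. R x) < ereal (m + inverse (real (Suc n)))"
      by (simp add: m)
    then show ?thesis
      unfolding INF_less_iff K_def by (auto intro: less_imp_le)
  qed
  moreover have "K n \<subseteq> K k" if "k \<le> n" for k n
    using that by (auto simp: K_def intro: order_trans elim!: order_trans)
  ultimately have "\<Inter> (range K) \<noteq> {}"
    using compact by (intro compact_nest) (auto simp: K_def)
  then obtain x where x: "\<And>n. x \<in> K n"
    by auto
  have "R x \<le> ereal m"
  proof (rule LIMSEQ_le_const)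
    have "(\<lambda>n. m + inverse (real (Suc n))) \<longlonglongrightarrow> m + 0"
      by (intro tendsto_intros LIMSEQ_inverse_real_of_nat)
    then show "(\<lambda>n. ereal (m + inverse (real (Suc n)))) \<longlonglongrightarrow> ereal m"
      by simp
  qed (use x in \<open>auto simp: K_def\<close>)
  with x[of 0] have xm: "x \<in> {x \<in> C. R x \<le> ereal m}"
    by (simp add: K_def)
  \<comment> \<open>The minimizers form the sublevel set at level \<open>m\<close> itself, so the
    compactness hypothesis applies once more.\<close>
  have "minimizers R C = {x \<in> C. R x \<le> ereal m}"
    using xm m_le unfolding minimizers_def is_arg_min_def
    by (auto simp: not_less intro: order_trans)
  with xm compact show ?thesis
    by auto
qed

lemma abs_vec_eq_iff:
  fixes v w :: "real ^ 'm"
  shows "\<bar>w\<bar> = v \<longleftrightarrow> (\<forall>i. \<bar>w $ i\<bar> = v $ i)"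
  by (simp add: vec_eq_iff abs_vec_def)

lemma compact_abs_vec_eq:
  fixes v :: "real ^ 'm"
  shows "compact {w. \<bar>w\<bar> = v}"
proof -
  have "bounded {w. \<bar>w\<bar> = v}"
    unfolding bounded_iff
  proof (intro exI ballI)
    fix w assume "w \<in> {w. \<bar>w\<bar> = v}"
    \<comment> \<open>The l1 norm is constant on the set, and it dominates the Euclidean
      norm.\<close>
    then have "(\<Sum>i\<in>UNIV. \<bar>w $ i\<bar>) = (\<Sum>i\<in>UNIV. v $ i)"
      by (simp add: abs_vec_eq_iff)
    then show "norm w \<le> (\<Sum>i\<in>UNIV. v $ i)"
      using norm_le_l1_cart[of w] by simp
  qed
  moreover have "closed {w. \<bar>w\<bar> = v}"
    unfolding abs_vec_eq_iff
    by (intro closed_Collect_all closed_Collect_eq continuous_intros)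
  ultimately show ?thesis
    by (simp add: compact_eq_bounded_closed)
qed

theorem proposition3p1:
  fixes A :: "real ^ 'n ^ 'm"
    and xbar :: "real ^ 'n"
    and ybar :: "real ^ 'm"
    and F :: "(real ^ 'm) set"
    and R :: "real ^ 'n \<Rightarrow> ereal"
  assumes ybar: "ybar = \<bar>A *v xbar\<bar>\<^sup>2"
    and F: "F = {w. \<bar>w\<bar> = vec_sqrt ybar}"
    and proper: "proper_fun R"
    and lsc: "lower_semicontinuous R"
    and feasible: "((*v) A ` eff_dom R) \<inter> F \<noteq> {}"
    and nonneg: "\<forall>x. 0 \<le> R x"
    and kernels: "fun_ker (asymptotic_fun R) \<inter> fun_ker ((*v) A) = {0}"
  shows "minimizers R {x. A *v x \<in> F} \<noteq> {} \<and> compact (minimizers R {x. A *v x \<in> F})"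
proof -
  have L: "bounded_linear ((*v) A)"
    by simp
  have F_compact: "compact F"
    unfolding F by (rule compact_abs_vec_eq)
  have "compact {x \<in> {x. A *v x \<in> F}. R x \<le> ereal c}" for c
  proof -
    \<comment> \<open>Compactness of \<open>F\<close> gives only closedness here, as
      \<open>A\<close> may have a nontrivial kernel; boundedness must come from the growth of
      \<open>R\<close> along that kernel.\<close>
    have "closed ((*v) A -` F)"
      using F_compact by (intro closed_vimage compact_imp_closed linear_continuous_on L)
    then have "closed ((*v) A -` F \<inter> {x. R x \<le> ereal c})"
      using closed_sublevel_lower_semicontinuous[OF lsc] by (rule closed_Int)
    moreover have "bounded {x. A *v x \<in> F \<and> R x \<le> ereal c}"
      using nonneg kernels F_compact
      by (intro bounded_sublevel_asymptotic L compact_imp_bounded) auto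
    ultimately show ?thesis
      by (simp add: compact_eq_bounded_closed vimage_def Int_def)
  qed
  moreover obtain x0 where "A *v x0 \<in> F" "R x0 < \<infinity>"
    using feasible by (auto simp: eff_dom_def)
  ultimately show ?thesis
    using nonneg by (intro minimizers_nonempty_compact[where ?x0.0 = x0]) auto
qed

end
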